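(* Let $\mathbb{F}=\mathbb{R}$ or $\mathbb{F}=\mathbb{C}$. For an arbitrary $w\in\mathbb{F}$ with $|w|>1$, the unbounded linear weighted backward shift operator \[ A_wx:=(w^kx_{k+1})_{k\in\mathbb{N}} \] in the space $c_0(\mathbb{N})$ with maximal domain \[ D(A_w):=\left\{x=(x_k)_{k\in\mathbb{N}}\in c_0(\mathbb{N}) : (w^kx_{k+1})_{k\in\mathbb{N}}\in c_0(\mathbb{N})\right\} \] is chaotic, as well as its every power $A_w^n$, $n\in\mathbb{N}$. Furthermore, each $\lambda\in\mathbb{F}$ is an eigenvalue of $A_w$ of geometric multiplicity $1$, i.e., \[ \dim\ker(A_w-\lambda I)=1. \] In particular, provided the underlying space is complex (i.e., $\mathbb{F}=\mathbb{C}$), $\sigma_p(A_w)=\mathbb{C}$.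
   Context: $\mathbb{N}=\{1,2,3,\dots\}$, $\mathbb{Z}_+=\{0,1,2,\dots\}$. $c_0(\mathbb{N})$ is the Banach space of $\mathbb{F}$-valued sequences $(x_k)_{k\in\mathbb{N}}$ with $\lim_{k\to\infty}x_k=0$, with the norm $\|x\|_\infty=\sup_{k\in\mathbb{N}}|x_k|$. Powers of an unbounded operator $A$ with domain $D(A)$ have their natural domains: $A^0:=I$ and $D(A^{n+1})=\{x\in D(A^n): A^nx\in D(A)\}$. For a (bounded or unbounded) linear operator $A$ with domain $D(A)$ in a real or complex Banach space $X$, put $C^\infty(A):=\bigcap_{n=0}^\infty D(A^n)$. A nonzero vector $x\in C^\infty(A)$ is hypercyclic for $A$ if its orbit $\{A^nx\}_{n\in\mathbb{Z}_+}$ is dense in $X$; $A$ is hypercyclic if it possesses a hypercyclic vector. A vector $x\in D(A^N)$ with $A^Nx=x$ for some $N\in\mathbb{N}$ is a periodic point of $A$. $A$ is chaotic if it is hypercyclic and the set of its periodic points is dense in $X$. The point spectrum $\sigma_p(A)$ of a closed linear operator $A$ in a complex Banach space is the set of $\lambda\in\mathbb{C}$ for which $A-\lambda I$ is not injective, i.e., the set of eigenvalues of $A$. *)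

theory Defs
  imports "HOL-Analysis.Analysis"
begin

section \<open>The Banach space of null sequences\<close>

text \<open>Sequences are indexed from 0: the entry \<open>x\<^sub>k\<close>, \<open>k = 1, 2, \<dots>\<close>, of a mathematical
  sequence is \<open>coord x (k - 1)\<close>.\<close>

typedef (overloaded) 'a c0 = "{x :: nat \<Rightarrow> 'a::real_normed_vector. x \<longlonglongrightarrow> 0}"
  morphisms coord Abs_c0
  by (rule exI[of _ "\<lambda>_. 0"]) simp

lemma coord_tendsto: "coord x \<longlonglongrightarrow> 0"
  using coord[of x] by simp

lemma coord_Abs_c0: "y \<longlonglongrightarrow> 0 \<Longrightarrow> coord (Abs_c0 y) = y"
  by (simp add: Abs_c0_inverse)

lemma c0_eqI: "(\<And>j. coord x j = coord y j) \<Longrightarrow> x = y"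
  by (metis coord_inject ext)

lemma bdd_above_coord: "bdd_above (range (\<lambda>j. norm (coord x j)))"
proof -
  have "Bseq (coord x)"
    using coord_tendsto convergentI convergent_imp_Bseq by blast
  then show ?thesis
    unfolding Bseq_def bdd_above_def by auto
qed

instantiation c0 :: (real_normed_vector) real_normed_vector
begin

definition "0 = Abs_c0 (\<lambda>_. 0)"
definition "x + y = Abs_c0 (\<lambda>j. coord x j + coord y j)"
definition "x - y = Abs_c0 (\<lambda>j. coord x j - coord y j)"
definition "- x = Abs_c0 (\<lambda>j. - coord x j)"
definition "r *\<^sub>R x = Abs_c0 (\<lambda>j. r *\<^sub>R coord x j)"
definition "norm x = (SUP j. norm (coord x j))"
definition "sgn x = scaleR (inverse (norm x)) x" for x :: "'a c0"
definition "dist x y = norm (x - y)" for x y :: "'a c0"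
definition "uniformity = (INF e\<in>{0<..}. principal {(x :: 'a c0, y). dist x y < e})"
definition "open U = (\<forall>x\<in>U. eventually (\<lambda>(x', y). x' = x \<longrightarrow> y \<in> U) uniformity)" for U :: "'a c0 set"

lemma coord_zero [simp]: "coord 0 j = 0"
  by (simp add: zero_c0_def coord_Abs_c0)

lemma coord_add [simp]: "coord (x + y) j = coord x j + coord y j"
  using tendsto_add[OF coord_tendsto[of x] coord_tendsto[of y]]
  by (simp add: plus_c0_def coord_Abs_c0)

lemma coord_diff [simp]: "coord (x - y) j = coord x j - coord y j"
  using tendsto_diff[OF coord_tendsto[of x] coord_tendsto[of y]]
  by (simp add: minus_c0_def coord_Abs_c0)

lemma coord_uminus [simp]: "coord (- x) j = - coord x j"
  using tendsto_minus[OF coord_tendsto[of x]]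
  by (simp add: uminus_c0_def coord_Abs_c0)

lemma coord_scaleR [simp]: "coord (r *\<^sub>R x) j = r *\<^sub>R coord x j"
  using tendsto_scaleR[OF tendsto_const coord_tendsto[of x]]
  by (simp add: scaleR_c0_def coord_Abs_c0)

lemma norm_coord_le: "norm (coord x j) \<le> norm x"
  unfolding norm_c0_def by (rule cSUP_upper[OF UNIV_I bdd_above_coord])

lemma norm_c0_leI: "(\<And>j. norm (coord x j) \<le> c) \<Longrightarrow> norm x \<le> c"
  unfolding norm_c0_def by (rule cSUP_least) auto

instance
proof
  fix x y :: "'a c0" and r s :: real
  show "norm x = 0 \<longleftrightarrow> x = 0"
  proof
    assume "norm x = 0"
    then have "coord x j = 0" for j
      using norm_coord_le[of x j] by simp
    then show "x = 0"
      by (intro c0_eqI) simp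
  qed (simp add: norm_c0_def)
  show "norm (x + y) \<le> norm x + norm y"
  proof (rule norm_c0_leI)
    fix j
    show "norm (coord (x + y) j) \<le> norm x + norm y"
      using norm_triangle_ineq[of "coord x j" "coord y j"] norm_coord_le[of x j]
        norm_coord_le[of y j] by simp
  qed
  show "norm (r *\<^sub>R x) = \<bar>r\<bar> * norm x"
  proof (rule antisym)
    show "norm (r *\<^sub>R x) \<le> \<bar>r\<bar> * norm x"
      by (rule norm_c0_leI) (simp add: mult_left_mono norm_coord_le)
    show "\<bar>r\<bar> * norm x \<le> norm (r *\<^sub>R x)"
    proof (cases "r = 0")
      case True
      then show ?thesis
        using norm_coord_le[of "r *\<^sub>R x" 0] by simp
    next
      case False
      have "norm x \<le> norm (r *\<^sub>R x) / \<bar>r\<bar>"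
      proof (rule norm_c0_leI)
        fix j
        show "norm (coord x j) \<le> norm (r *\<^sub>R x) / \<bar>r\<bar>"
          using norm_coord_le[of "r *\<^sub>R x" j] False by (simp add: field_simps)
      qed
      then show ?thesis
        using False by (simp add: field_simps)
    qed
  qed
qed (auto intro!: c0_eqI simp: sgn_c0_def dist_c0_def uniformity_c0_def open_c0_def
       scaleR_add_right scaleR_add_left)

end

instance c0 :: (banach) banach
proof
  fix X :: "nat \<Rightarrow> 'a c0"
  assume X: "Cauchy X"
  have "Cauchy (\<lambda>n. coord (X n) j)" for j
  proof (rule metric_CauchyI)
    fix e :: real assume "0 < e"
    then obtain M where M: "\<And>m n. m \<ge> M \<Longrightarrow> n \<ge> M \<Longrightarrow> dist (X m) (X n) < e"
      using X metric_CauchyD by metis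
    have "dist (coord (X m) j) (coord (X n) j) < e" if "m \<ge> M" "n \<ge> M" for m n
      using M[OF that] norm_coord_le[of "X m - X n" j] by (simp add: dist_norm)
    then show "\<exists>M. \<forall>m\<ge>M. \<forall>n\<ge>M. dist (coord (X m) j) (coord (X n) j) < e"
      by blast
  qed
  then have "\<forall>j. \<exists>l. (\<lambda>n. coord (X n) j) \<longlonglongrightarrow> l"
    by (simp add: Cauchy_convergent_iff convergent_def)
  then obtain y where y: "\<And>j. (\<lambda>n. coord (X n) j) \<longlonglongrightarrow> y j"
    by metis
  have near: "\<exists>M. \<forall>m\<ge>M. \<forall>j. norm (coord (X m) j - y j) \<le> e" if "0 < e" for e
  proof -
    obtain M where M: "\<And>m n. m \<ge> M \<Longrightarrow> n \<ge> M \<Longrightarrow> dist (X m) (X n) < e"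
      using X metric_CauchyD \<open>0 < e\<close> by metis
    have "norm (coord (X m) j - y j) \<le> e" if "m \<ge> M" for m j
    proof (rule Lim_bounded)
      show "(\<lambda>n. norm (coord (X m) j - coord (X n) j)) \<longlonglongrightarrow> norm (coord (X m) j - y j)"
        by (intro tendsto_intros y)
      show "\<forall>n\<ge>M. norm (coord (X m) j - coord (X n) j) \<le> e"
      proof (intro allI impI)
        fix n assume "n \<ge> M"
        then show "norm (coord (X m) j - coord (X n) j) \<le> e"
          using M[OF that, of n] norm_coord_le[of "X m - X n" j] by (simp add: dist_norm)
      qed
    qed
    then show ?thesis by blast
  qed
  have y0: "y \<longlonglongrightarrow> 0"
  proof (rule LIMSEQ_I)
    fix e :: real assume "0 < e"
    then obtain M where M: "\<And>j. norm (coord (X M) j - y j) \<le> e / 2"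
      using near[of "e / 2"] by auto
    obtain J where J: "\<And>j. j \<ge> J \<Longrightarrow> norm (coord (X M) j) < e / 2"
      using LIMSEQ_D[OF coord_tendsto[of "X M"], of "e / 2"] \<open>0 < e\<close> by auto
    have "norm (y j - 0) < e" if "j \<ge> J" for j
      using M[of j] J[OF that] norm_triangle_ineq2[of "y j" "coord (X M) j"]
      by (simp add: norm_minus_commute)
    then show "\<exists>J. \<forall>j\<ge>J. norm (y j - 0) < e" by blast
  qed
  have "X \<longlonglongrightarrow> Abs_c0 y"
  proof (rule LIMSEQ_I)
    fix e :: real assume "0 < e"
    then obtain M where M: "\<And>m j. m \<ge> M \<Longrightarrow> norm (coord (X m) j - y j) \<le> e / 2"
      using near[of "e / 2"] by auto
    have "norm (X m - Abs_c0 y) < e" if "m \<ge> M" for m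
      using norm_c0_leI[of "X m - Abs_c0 y" "e / 2"] M[OF that] \<open>0 < e\<close>
      by (simp add: coord_Abs_c0[OF y0])
    then show "\<exists>M. \<forall>m\<ge>M. norm (X m - Abs_c0 y) < e" by blast
  qed
  then show "convergent X" by (rule convergentI)
qed

text \<open>The type class structure of \<open>c0\<close> only covers real scalars; multiplication by scalars from
  the underlying field is the following function.\<close>

definition scale_c0 :: "'a::real_normed_field \<Rightarrow> 'a c0 \<Rightarrow> 'a c0" where
  "scale_c0 a x = Abs_c0 (\<lambda>j. a * coord x j)"

lemma coord_scale_c0 [simp]: "coord (scale_c0 a x) j = a * coord x j"
  using tendsto_mult_right_zero[OF coord_tendsto[of x], of a]
  by (simp add: scale_c0_def coord_Abs_c0)

lemma vector_space_scale_c0: "vector_space (scale_c0 :: 'a::real_normed_field \<Rightarrow> _)"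
  by unfold_locales (auto intro!: c0_eqI simp: algebra_simps)

lemma scale_c0_of_real: "scale_c0 (of_real r) x = r *\<^sub>R x"
  by (rule c0_eqI) (simp add: scaleR_conv_of_real)

lemma norm_scale_c0: "norm (scale_c0 a x) = norm a * norm x"
proof (rule antisym)
  have le: "norm (scale_c0 b z) \<le> norm b * norm z" for b and z :: "'a c0"
    by (rule norm_c0_leI) (simp add: norm_mult mult_left_mono norm_coord_le)
  show "norm (scale_c0 a x) \<le> norm a * norm x"
    by (rule le)
  show "norm a * norm x \<le> norm (scale_c0 a x)"
  proof (cases "a = 0")
    case False
    then have "scale_c0 (inverse a) (scale_c0 a x) = x"
      by (intro c0_eqI) simp
    then have "norm x \<le> norm (inverse a) * norm (scale_c0 a x)"
      using le[of "inverse a" "scale_c0 a x"] by simp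
    then show ?thesis
      using False by (simp add: norm_inverse norm_divide field_simps)
  qed simp
qed


section \<open>Operators with a domain\<close>

text \<open>A not necessarily everywhere defined operator \<open>A\<close> in \<open>X\<close> is a partial map, with
  \<open>D(A) = dom A\<close>. Since \<open>\<circ>\<^sub>m\<close> is composition with the natural domain, so are the powers below.\<close>

primrec op_power :: "('x \<rightharpoonup> 'x) \<Rightarrow> nat \<Rightarrow> ('x \<rightharpoonup> 'x)" where
  "op_power A 0 = Some"
| "op_power A (Suc n) = A \<circ>\<^sub>m op_power A n"

lemma dom_op_power_Suc:
  "dom (op_power A (Suc n)) = {x \<in> dom (op_power A n). the (op_power A n x) \<in> dom A}"
  by (auto simp: map_comp_def split: option.splits)

lemma op_power_1: "op_power A 1 = A"
  by (auto simp: map_comp_def)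

definition C_infinity :: "('x \<rightharpoonup> 'x) \<Rightarrow> 'x set" where
  "C_infinity A = (\<Inter>n. dom (op_power A n))"

definition hypercyclic_vector :: "('x::real_normed_vector \<rightharpoonup> 'x) \<Rightarrow> 'x \<Rightarrow> bool" where
  "hypercyclic_vector A x \<longleftrightarrow>
     x \<noteq> 0 \<and> x \<in> C_infinity A \<and> closure (range (\<lambda>n. the (op_power A n x))) = UNIV"

definition hypercyclic :: "('x::real_normed_vector \<rightharpoonup> 'x) \<Rightarrow> bool" where
  "hypercyclic A \<longleftrightarrow> (\<exists>x. hypercyclic_vector A x)"

definition periodic_point :: "('x \<rightharpoonup> 'x) \<Rightarrow> 'x \<Rightarrow> bool" where
  "periodic_point A x \<longleftrightarrow> (\<exists>N\<ge>1. op_power A N x = Some x)"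

definition chaotic :: "('x::real_normed_vector \<rightharpoonup> 'x) \<Rightarrow> bool" where
  "chaotic A \<longleftrightarrow> hypercyclic A \<and> closure {x. periodic_point A x} = UNIV"

text \<open>In the following notions \<open>smul\<close> is the scalar multiplication of the space.\<close>

definition op_minus_scalar ::
    "('f \<Rightarrow> 'x \<Rightarrow> 'x) \<Rightarrow> ('x::ab_group_add \<rightharpoonup> 'x) \<Rightarrow> 'f \<Rightarrow> ('x \<rightharpoonup> 'x)" where
  "op_minus_scalar smul A l = (\<lambda>x. map_option (\<lambda>y. y - smul l x) (A x))"

definition op_kernel :: "('x::zero \<rightharpoonup> 'x) \<Rightarrow> 'x set" where
  "op_kernel A = {x. A x = Some 0}"

definition eigenvalue :: "('f \<Rightarrow> 'x \<Rightarrow> 'x) \<Rightarrow> ('x::zero \<rightharpoonup> 'x) \<Rightarrow> 'f \<Rightarrow> bool" where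
  "eigenvalue smul A l \<longleftrightarrow> (\<exists>x. x \<noteq> 0 \<and> A x = Some (smul l x))"

definition point_spectrum ::
    "(complex \<Rightarrow> 'x \<Rightarrow> 'x) \<Rightarrow> ('x::ab_group_add \<rightharpoonup> 'x) \<Rightarrow> complex set" where
  "point_spectrum smul A =
     {l. \<not> inj_on (\<lambda>x. the (op_minus_scalar smul A l x)) (dom (op_minus_scalar smul A l))}"

definition linear_op :: "('f \<Rightarrow> 'x \<Rightarrow> 'x) \<Rightarrow> ('x::ab_group_add \<rightharpoonup> 'x) \<Rightarrow> bool" where
  "linear_op smul A \<longleftrightarrow> A 0 = Some 0 \<and>
     (\<forall>x y u v. A x = Some u \<longrightarrow> A y = Some v \<longrightarrow> A (x + y) = Some (u + v)) \<and>
     (\<forall>a x u. A x = Some u \<longrightarrow> A (smul a x) = Some (smul a u))"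

definition closed_op :: "('x::real_normed_vector \<rightharpoonup> 'x) \<Rightarrow> bool" where
  "closed_op A \<longleftrightarrow> closed {(x, y). A x = Some y}"

definition bounded_op :: "('x::real_normed_vector \<rightharpoonup> 'x) \<Rightarrow> bool" where
  "bounded_op A \<longleftrightarrow> (\<exists>C. \<forall>x y. A x = Some y \<longrightarrow> norm y \<le> C * norm x)"


section \<open>The weighted backward shift\<close>

text \<open>With indices from 0, \<open>(A\<^sub>w x)\<^sub>k = w\<^sup>k x\<^sub>k\<^sub>+\<^sub>1\<close> for \<open>k = j + 1\<close> becomes
  \<open>w ^ Suc j * coord x (Suc j)\<close>.\<close>

definition wshift_seq :: "'a::real_normed_field \<Rightarrow> 'a c0 \<Rightarrow> nat \<Rightarrow> 'a" where
  "wshift_seq w x = (\<lambda>j. w ^ Suc j * coord x (Suc j))"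

definition wshift :: "'a::real_normed_field \<Rightarrow> ('a c0 \<rightharpoonup> 'a c0)" where
  "wshift w = (\<lambda>x. if wshift_seq w x \<longlonglongrightarrow> 0 then Some (Abs_c0 (wshift_seq w x)) else None)"

lemma dom_wshift: "dom (wshift w) = {x. wshift_seq w x \<longlonglongrightarrow> 0}"
  by (auto simp: wshift_def split: if_splits)

lemma wshift_eq_Some_iff:
  "wshift w x = Some y \<longleftrightarrow> (\<forall>j. coord y j = w ^ Suc j * coord x (Suc j))"
proof
  assume "wshift w x = Some y"
  then show "\<forall>j. coord y j = w ^ Suc j * coord x (Suc j)"
    by (auto simp: wshift_def wshift_seq_def coord_Abs_c0 simp del: power_Suc split: if_splits)
next
  assume "\<forall>j. coord y j = w ^ Suc j * coord x (Suc j)"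
  then have "wshift_seq w x = coord y"
    by (auto simp: wshift_seq_def)
  then show "wshift w x = Some y"
    by (simp add: wshift_def coord_tendsto coord_inverse)
qed

lemma linear_op_wshift: "linear_op scale_c0 (wshift w)"
  by (auto simp: linear_op_def wshift_eq_Some_iff algebra_simps)

lemma continuous_on_coord: "continuous_on S (\<lambda>x. coord x j)"
proof (rule continuous_on_subset[OF _ subset_UNIV])
  have "bounded_linear (\<lambda>x :: 'a c0. coord x j)"
    by (rule bounded_linear_intro[of _ 1]) (auto simp: norm_coord_le)
  then show "continuous_on UNIV (\<lambda>x :: 'a c0. coord x j)"
    by (rule linear_continuous_on)
qed

lemma closed_op_wshift: "closed_op (wshift w)"
proof -
  have "closed {p :: 'a c0 \<times> 'a c0. coord (snd p) j = w ^ Suc j * coord (fst p) (Suc j)}" for j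
    by (intro closed_Collect_eq continuous_intros
        continuous_on_compose2[OF continuous_on_coord[of UNIV]]) auto
  then have "closed (\<Inter>j. {p :: 'a c0 \<times> 'a c0. coord (snd p) j = w ^ Suc j * coord (fst p) (Suc j)})"
    by blast
  moreover have "(\<Inter>j. {p :: 'a c0 \<times> 'a c0. coord (snd p) j = w ^ Suc j * coord (fst p) (Suc j)})
      = {(x, y). wshift w x = Some y}"
    by (auto simp: wshift_eq_Some_iff)
  ultimately show ?thesis
    by (simp add: closed_op_def)
qed

lemma unbounded_wshift:
  assumes "norm w > 1"
  shows "\<not> bounded_op (wshift w)"
proof
  assume "bounded_op (wshift w)"
  then obtain C where C: "\<And>x y. wshift w x = Some y \<Longrightarrow> norm y \<le> C * norm x"
    by (auto simp: bounded_op_def)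
  define e :: "nat \<Rightarrow> 'a c0" where "e n = Abs_c0 (\<lambda>j. if j = n then 1 else 0)" for n
  have lim: "(\<lambda>j. if j = n then 1 else 0 :: 'a) \<longlonglongrightarrow> 0" for n
    by (rule tendsto_eventually)
      (use eventually_gt_at_top[of n] in \<open>auto elim: eventually_mono\<close>)
  have coord_e: "coord (e n) j = (if j = n then 1 else 0)" for n j
    by (simp add: e_def coord_Abs_c0[OF lim])
  have norm_e: "norm (e n) = 1" for n
    using norm_coord_le[of "e n" n] norm_c0_leI[of "e n" 1] by (simp add: coord_e)
  have "norm w ^ Suc n \<le> C" for n
  proof -
    have "wshift w (e (Suc n)) = Some (scale_c0 (w ^ Suc n) (e n))"
      by (simp add: wshift_eq_Some_iff coord_e)
    from C[OF this] show ?thesis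
      by (simp add: norm_scale_c0 norm_e norm_power norm_mult)
  qed
  moreover obtain n where "C < norm w ^ n"
    using real_arch_pow[OF assms] by blast
  moreover have "norm w ^ n \<le> norm w ^ Suc n"
    using assms by (intro power_increasing) auto
  ultimately show False
    by (meson not_le order_trans)
qed

end

theory Submission
  imports Defs
begin

text \<open>Put \<open>t\<^sub>k = 1 + 2 + \<dots> + k\<close>. Writing \<open>x\<^sub>k = y\<^sub>k / w\<^bsup>t\<^sub>k\<^esup>\<close> turns the weighted shift \<open>x \<mapsto> (w\<^bsup>k+1\<^esup> x\<^sub>k\<^sub>+\<^sub>1)\<close>
  into the plain shift \<open>y \<mapsto> (y\<^sub>k\<^sub>+\<^sub>1)\<close>, and since \<open>\<bar>w\<bar>\<^bsup>t\<^sub>k\<^esup>\<close> outgrows every geometric sequence, each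
  sequence \<open>y\<close> of at most exponential growth arises from some \<open>x\<close> in \<open>c\<^sub>0\<close>
  (\<open>op_power_wshift_unweight\<close>). All vectors that the theorem asks for are obtained by choosing
  such a \<open>y\<close>, for which the plain shift is transparent.

  \<^item> Eigenvectors come from \<open>y\<^sub>k = \<lambda>\<^sup>k\<close>; the recursion \<open>y\<^sub>k\<^sub>+\<^sub>1 = \<lambda> y\<^sub>k\<close> shows that there are no
    others, up to scalars (\<open>op_kernel_wshift\<close>).
  \<^item> Periodic points come from periodic \<open>y\<close>. Repeating a long initial segment of an arbitrary
    vector changes it only at late indices, where the weights make the change small
    (\<open>periodic_approximation\<close>).
  \<^item> A hypercyclic vector comes from a \<open>y\<close> in which all members of a countable dense family
    occur as blocks, each infinitely often. If a block starts at \<open>n\<close>, then the \<open>n\<close>-fold shift of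
    \<open>y\<close> agrees with the member until the next block begins, and by making the blocks long enough
    the rest is damped by the weights (\<open>concatenate_blocks\<close>).

  A power \<open>A\<^sup>N\<close> requires only that the blocks start at multiples of \<open>N\<close>, and a point of period
  \<open>M\<close> for \<open>A\<close> also satisfies \<open>(A\<^sup>N)\<^sup>M x = x\<close>. So all powers are handled at once.\<close>

section \<open>Powers of partial operators\<close>

lemma op_power_add: "op_power A (m + n) = op_power A m \<circ>\<^sub>m op_power A n"
proof (induction m)
  case 0
  show ?case
    by (auto simp: map_comp_def split: option.splits)
next
  case (Suc m)
  then show ?case
    by (auto simp: map_comp_def split: option.splits)
qed

lemma op_power_mult: "op_power (op_power A n) m = op_power A (n * m)"
  by (induction m) (simp_all add: op_power_add)

section \<open>Conjugation with the unweighted shift\<close>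

lemma triangle_add_le: "triangle m + k \<le> triangle (m + k)"
  by (induction k) auto

lemma le_triangle: "k \<le> triangle k"
  using triangle_add_le[of 0 k] by simp

definition exp_growth :: "(nat \<Rightarrow> 'a::real_normed_field) \<Rightarrow> bool" where
  "exp_growth y \<longleftrightarrow> (\<exists>K r. r \<ge> 0 \<and> (\<forall>k. norm (y k) \<le> K * r ^ k))"

lemma exp_growthI: "r \<ge> 0 \<Longrightarrow> (\<And>k. norm (y k) \<le> K * r ^ k) \<Longrightarrow> exp_growth y"
  unfolding exp_growth_def by blast

lemma exp_growth_bounded: "(\<And>k. norm (y k) \<le> K) \<Longrightarrow> exp_growth y"
  by (rule exp_growthI[of 1 y K]) auto

lemma exp_growth_shift:
  assumes "exp_growth y"
  shows "exp_growth (\<lambda>k. y (n + k))"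
proof -
  obtain K r where "r \<ge> 0" and K: "\<And>k. norm (y k) \<le> K * r ^ k"
    using assms unfolding exp_growth_def by blast
  have "norm (y (n + k)) \<le> (K * r ^ n) * r ^ k" for k
    using K[of "n + k"] by (simp add: power_add mult.assoc)
  with \<open>r \<ge> 0\<close> show ?thesis
    by (rule exp_growthI)
qed

lemma exp_over_triangle_tendsto_0:
  fixes a r :: real
  assumes "a > 1" "r \<ge> 0"
  shows "(\<lambda>k. r ^ k / a ^ triangle k) \<longlonglongrightarrow> 0"
proof -
  obtain s where s: "2 * r < a ^ s"
    using real_arch_pow[OF \<open>a > 1\<close>] by blast
  have nonneg: "r ^ k / a ^ triangle k \<ge> 0" for k
    using assms by simp
  \<comment> \<open>Consecutive terms have the quotient \<open>r / a ^ Suc k\<close>, which is at most \<open>1/2\<close> from \<open>s\<close> on.\<close>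
  have "norm (r ^ Suc k / a ^ triangle (Suc k)) \<le> 1/2 * norm (r ^ k / a ^ triangle k)"
    if "k \<ge> s" for k
  proof -
    have "a ^ s \<le> a ^ Suc k"
      using that assms by (intro power_increasing) auto
    with s have "r / a ^ Suc k \<le> 1/2"
      using \<open>a > 1\<close> by (simp add: field_simps)
    then have "r / a ^ Suc k * (r ^ k / a ^ triangle k) \<le> 1/2 * (r ^ k / a ^ triangle k)"
      using assms by (intro mult_right_mono) auto
    moreover have "r / a ^ Suc k * (r ^ k / a ^ triangle k) = r ^ Suc k / a ^ triangle (Suc k)"
      by (simp add: power_add mult_ac)
    ultimately show ?thesis
      using nonneg[of k] nonneg[of "Suc k"] by (simp only: real_norm_def abs_of_nonneg)
  qed
  then have "summable (\<lambda>k. r ^ k / a ^ triangle k)"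
    by (intro summable_ratio_test[of "1/2" s]) auto
  then show ?thesis
    by (rule summable_LIMSEQ_zero)
qed

lemma exp_growth_unweight_tendsto_0:
  assumes "norm w > 1" "exp_growth y"
  shows "(\<lambda>k. y k / w ^ triangle k) \<longlonglongrightarrow> 0"
proof -
  obtain K r where "r \<ge> 0" and K: "\<And>k. norm (y k) \<le> K * r ^ k"
    using assms unfolding exp_growth_def by blast
  have "(\<lambda>k. K * (r ^ k / norm w ^ triangle k)) \<longlonglongrightarrow> 0"
    by (intro tendsto_mult_right_zero exp_over_triangle_tendsto_0 assms \<open>r \<ge> 0\<close>)
  then show ?thesis
  proof (rule Lim_null_comparison[rotated])
    show "\<forall>\<^sub>F k in sequentially. norm (y k / w ^ triangle k) \<le> K * (r ^ k / norm w ^ triangle k)"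
      using K by (intro always_eventually allI)
        (simp add: norm_divide norm_power divide_right_mono)
  qed
qed

definition unweight :: "'a::real_normed_field \<Rightarrow> (nat \<Rightarrow> 'a) \<Rightarrow> 'a c0" where
  "unweight w y = Abs_c0 (\<lambda>k. y k / w ^ triangle k)"

lemma coord_unweight:
  "norm w > 1 \<Longrightarrow> exp_growth y \<Longrightarrow> coord (unweight w y) k = y k / w ^ triangle k"
  by (simp add: unweight_def coord_Abs_c0 exp_growth_unweight_tendsto_0)

lemma wshift_unweight:
  assumes "norm w > 1" "exp_growth y"
  shows "wshift w (unweight w y) = Some (unweight w (\<lambda>k. y (Suc k)))"
proof -
  have "exp_growth (\<lambda>k. y (Suc k))"
    using exp_growth_shift[OF assms(2), of 1] by simp
  moreover have "w \<noteq> 0"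
    using assms by auto
  ultimately show ?thesis
    unfolding wshift_eq_Some_iff
    using assms by (simp add: coord_unweight power_add field_simps)
qed

text \<open>The point of asking for exponential growth: it is inherited by all shifts, so such vectors
  lie in the domains of all powers.\<close>

lemma op_power_wshift_unweight:
  assumes "norm w > 1" "exp_growth y"
  shows "op_power (wshift w) n (unweight w y) = Some (unweight w (\<lambda>k. y (n + k)))"
proof (induction n)
  case (Suc n)
  then show ?case
    using wshift_unweight[OF assms(1) exp_growth_shift[OF assms(2), of n]]
    by (simp add: map_comp_def)
qed simp

lemma norm_unweight_diff_le:
  assumes "norm w > 1" "exp_growth y" "exp_growth z"
    and "\<And>k. norm (y k - z k) \<le> e * norm w ^ k"
  shows "norm (unweight w y - unweight w z) \<le> e"
proof (rule norm_c0_leI)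
  fix k
  have "e \<ge> 0"
    using order_trans[OF norm_ge_zero assms(4)[of 0]] by simp
  have "norm w ^ k \<le> norm w ^ triangle k"
    using assms(1) by (intro power_increasing le_triangle) auto
  then have "norm (y k - z k) \<le> e * norm w ^ triangle k"
    using assms(4)[of k] mult_left_mono[OF _ \<open>e \<ge> 0\<close>] order_trans by blast
  moreover have "norm w ^ triangle k > 0"
    using assms(1) by (intro zero_less_power) linarith
  ultimately have "norm (y k - z k) / norm w ^ triangle k \<le> e"
    by (simp add: pos_divide_le_eq)
  then show "norm (coord (unweight w y - unweight w z) k) \<le> e"
    using assms(1-3)
    by (simp add: coord_unweight flip: diff_divide_distrib) (simp add: norm_divide norm_power)
qed

lemma coord_eventually_small:
  assumes "e > 0"
  obtains M where "\<And>k. k \<ge> M \<Longrightarrow> norm (coord x k) < e"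
  using LIMSEQ_D[OF coord_tendsto[of x] assms] by auto

section \<open>Eigenvectors\<close>

lemma exp_growth_power: "exp_growth (\<lambda>k. l ^ k)"
  by (rule exp_growthI[of "norm l" _ 1]) (simp_all add: norm_power)

lemma unweight_power_nonzero:
  assumes "norm w > 1"
  shows "unweight w (\<lambda>k. l ^ k) \<noteq> 0"
proof
  assume "unweight w (\<lambda>k. l ^ k) = 0"
  then show False
    using coord_unweight[OF assms exp_growth_power, of l 0] by simp
qed

lemma op_kernel_op_minus_scalar:
  "x \<in> op_kernel (op_minus_scalar smul A l) \<longleftrightarrow> A x = Some (smul l x)"
  by (auto simp: op_kernel_def op_minus_scalar_def)

lemma wshift_unweight_power:
  assumes "norm w > 1"
  shows "wshift w (unweight w (\<lambda>k. l ^ k)) = Some (scale_c0 l (unweight w (\<lambda>k. l ^ k)))"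
proof -
  have w: "w \<noteq> 0"
    using assms by auto
  show ?thesis
    unfolding wshift_eq_Some_iff
    using w by (simp add: coord_unweight[OF assms exp_growth_power] power_add field_simps)
qed

lemma op_kernel_wshift:
  assumes "norm w > 1"
  shows "op_kernel (op_minus_scalar scale_c0 (wshift w) l)
    = range (\<lambda>c. scale_c0 c (unweight w (\<lambda>k. l ^ k)))"
proof (intro subset_antisym subsetI)
  fix x assume "x \<in> op_kernel (op_minus_scalar scale_c0 (wshift w) l)"
  then have rec: "l * coord x k = w ^ Suc k * coord x (Suc k)" for k
    unfolding op_kernel_op_minus_scalar wshift_eq_Some_iff by simp
  have w: "w \<noteq> 0"
    using assms by auto
  have "w ^ triangle k * coord x k = coord x 0 * l ^ k" for k
  proof (induction k)
    case (Suc k)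
    have "w ^ triangle (Suc k) * coord x (Suc k) = w ^ triangle k * (l * coord x k)"
      unfolding rec by (simp add: power_add mult_ac)
    with Suc show ?case
      by (simp add: mult_ac)
  qed simp
  then have "coord x k = coord (scale_c0 (coord x 0) (unweight w (\<lambda>k. l ^ k))) k" for k
    using w by (simp add: coord_unweight[OF assms exp_growth_power] nonzero_eq_divide_eq mult.commute)
  then have "x = scale_c0 (coord x 0) (unweight w (\<lambda>k. l ^ k))"
    by (rule c0_eqI)
  then show "x \<in> range (\<lambda>c. scale_c0 c (unweight w (\<lambda>k. l ^ k)))"
    by blast
next
  fix x assume "x \<in> range (\<lambda>c. scale_c0 c (unweight w (\<lambda>k. l ^ k)))"
  then obtain c where x: "x = scale_c0 c (unweight w (\<lambda>k. l ^ k))"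
    by blast
  have "scale_c0 l x = scale_c0 c (scale_c0 l (unweight w (\<lambda>k. l ^ k)))"
    unfolding x by (rule c0_eqI) simp
  then show "x \<in> op_kernel (op_minus_scalar scale_c0 (wshift w) l)"
    using wshift_unweight_power[OF assms, of l] linear_op_wshift[of w]
    unfolding x op_kernel_op_minus_scalar linear_op_def by metis
qed

lemma eigenvalue_wshift:
  assumes "norm w > 1"
  shows "eigenvalue scale_c0 (wshift w) l"
  using unweight_power_nonzero[OF assms] wshift_unweight_power[OF assms]
  unfolding eigenvalue_def by blast

lemma dim_op_kernel_wshift:
  fixes w :: "'a::real_normed_field"
  assumes "norm w > 1"
  shows "vector_space.dim scale_c0 (op_kernel (op_minus_scalar scale_c0 (wshift w) l)) = 1"
proof -
  interpret vector_space "scale_c0 :: 'a \<Rightarrow> 'a c0 \<Rightarrow> 'a c0"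
    by (rule vector_space_scale_c0)
  let ?v = "unweight w (\<lambda>k. l ^ k)"
  have "op_kernel (op_minus_scalar scale_c0 (wshift w) l) = span {?v}"
    unfolding op_kernel_wshift[OF assms] span_singleton ..
  moreover have "independent {?v}"
    using unweight_power_nonzero[OF assms] by simp
  ultimately show ?thesis
    using dim_eq_card_independent[of "{?v}"] by (simp add: dim_span)
qed

lemma eigenvalue_in_point_spectrum:
  assumes "linear_op smul A" "eigenvalue smul A l" "smul l 0 = 0"
  shows "l \<in> point_spectrum smul A"
proof -
  obtain x where "x \<noteq> 0" "A x = Some (smul l x)"
    using assms(2) unfolding eigenvalue_def by blast
  moreover have "A 0 = Some 0"
    using assms(1) unfolding linear_op_def by blast
  ultimately have "op_minus_scalar smul A l x = Some 0" "op_minus_scalar smul A l 0 = Some 0"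
    using assms(3) by (simp_all add: op_minus_scalar_def)
  with \<open>x \<noteq> 0\<close> show ?thesis
    by (auto simp: point_spectrum_def dest: inj_onD[where x = x and y = 0])
qed

section \<open>Periodic points\<close>

text \<open>Repeat the first \<open>M\<close> entries of \<open>y\<^sub>k = w\<^bsup>t\<^sub>k\<^esup> x\<^sub>k\<close>. From index \<open>M\<close> on, the entry
  of the resulting vector at \<open>k\<close> is an entry of \<open>x\<close> divided by \<open>w\<close> to the power
  \<open>t\<^sub>k - t\<^bsub>k mod M\<^esub> \<ge> M\<close>.\<close>

lemma periodic_approximation:
  assumes "norm w > 1" "e > 0"
  obtains M y where "M \<ge> 1" "exp_growth y" "\<And>k. y (M + k) = y k" "norm (unweight w y - x) < e"
proof -
  obtain M1 where M1: "\<And>k. k \<ge> M1 \<Longrightarrow> norm (coord x k) < e / 3"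
    using coord_eventually_small[of "e / 3" x] assms(2) by auto
  obtain M2 where M2: "3 * norm x / e < norm w ^ M2"
    using real_arch_pow[OF assms(1)] by blast
  define M where "M = max 1 (max M1 M2)"
  define y where "y k = w ^ triangle (k mod M) * coord x (k mod M)" for k
  have "M \<ge> 1" "M \<ge> M1" "M \<ge> M2"
    by (auto simp: M_def)
  have w: "w \<noteq> 0"
    using assms by auto
  have growth: "exp_growth y"
  proof (rule exp_growth_bounded)
    fix k
    have "k mod M + (M - k mod M) = M"
      using mod_less_divisor[of M k] \<open>M \<ge> 1\<close> by linarith
    then have "triangle (k mod M) \<le> triangle M"
      using triangle_add_le[of "k mod M" "M - k mod M"] by (metis add_leE)
    then have "norm w ^ triangle (k mod M) \<le> norm w ^ triangle M"
      using assms(1) by (intro power_increasing) simp_all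
    then show "norm (y k) \<le> norm w ^ triangle M * norm x"
      unfolding y_def norm_mult norm_power by (intro mult_mono norm_coord_le) auto
  qed
  have "norm (coord (unweight w y - x) k) \<le> 2 * e / 3" for k
  proof (cases "k < M")
    case True
    then show ?thesis
      using assms w by (simp add: coord_unweight growth y_def)
  next
    case False
    define i where "i = k mod M"
    have "i + M \<le> k"
    proof -
      have "M * 1 \<le> M * (k div M)"
        using False \<open>M \<ge> 1\<close> by (intro mult_le_mono2) (simp add: div_greater_zero_iff Suc_leI)
      then show ?thesis
        using mod_mult_div_eq[of k M] unfolding i_def by linarith
    qed
    then have "triangle i + M2 \<le> triangle k"
      using triangle_add_le[of i "k - i"] \<open>M \<ge> M2\<close> by simp
    then have "norm w ^ triangle i * norm w ^ M2 \<le> norm w ^ triangle k"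
      using assms(1) by (subst power_add[symmetric], intro power_increasing) auto
    then have le: "norm w ^ triangle i / norm w ^ triangle k \<le> 1 / norm w ^ M2"
      using w by (simp add: field_simps)
    have "norm (coord (unweight w y) k)
        = norm w ^ triangle i / norm w ^ triangle k * norm (coord x i)"
      using assms(1) by (simp add: coord_unweight growth y_def i_def norm_divide norm_mult norm_power)
    also have "\<dots> \<le> 1 / norm w ^ M2 * norm x"
      by (intro mult_mono le norm_coord_le) auto
    also have "\<dots> \<le> e / 3"
      using M2 assms(2) w by (simp add: field_simps)
    finally show ?thesis
      using norm_triangle_ineq4[of "coord (unweight w y) k" "coord x k"] M1[of k] False \<open>M \<ge> M1\<close>
      by simp
  qed
  then have "norm (unweight w y - x) \<le> 2 * e / 3"
    by (rule norm_c0_leI)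
  then have "norm (unweight w y - x) < e"
    using assms(2) by simp
  moreover have "y (M + k) = y k" for k
    by (simp add: y_def)
  ultimately show ?thesis
    using that[OF \<open>M \<ge> 1\<close> growth] by blast
qed

lemma periodic_points_dense:
  assumes "norm w > 1"
  shows "closure {x. periodic_point (op_power (wshift w) N) x} = UNIV"
proof -
  have "\<exists>z\<in>{x. periodic_point (op_power (wshift w) N) x}. dist z x < e" if e: "e > 0" for x e
  proof -
    obtain M y where M: "M \<ge> 1" "exp_growth y" "\<And>k. y (M + k) = y k" "norm (unweight w y - x) < e"
      using periodic_approximation[OF assms e] by blast
    have "y (N * M + k) = y k" for k
    proof (induction N)
      case (Suc N)
      then show ?case
        using M(3)[of "N * M + k"] by (simp add: add.assoc)
    qed simp
    then have "op_power (op_power (wshift w) N) M (unweight w y) = Some (unweight w y)"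
      by (simp add: op_power_mult op_power_wshift_unweight[OF assms M(2)])
    then have "periodic_point (op_power (wshift w) N) (unweight w y)"
      unfolding periodic_point_def using M(1) by blast
    with M(4) show ?thesis
      by (auto simp: dist_norm)
  qed
  then show ?thesis
    unfolding set_eq_iff closure_approachable by blast
qed

section \<open>A hypercyclic vector\<close>

text \<open>Lay initial segments of \<open>p 0, p 1, p 2, \<dots>\<close> one after the other. Seen from \<open>n i\<close>, the
  result differs from \<open>p i\<close> only from the end of the \<open>i\<close>-th block on. There both are bounded:
  the length of block \<open>i\<close> is chosen so that \<open>a\<close> to this power beats the bounds on \<open>p i\<close> and on
  \<open>p (i + 1)\<close> by a factor that grows with \<open>i\<close>.\<close>

lemma concatenate_blocks:
  fixes p :: "nat \<Rightarrow> nat \<Rightarrow> 'b::real_normed_vector" and a :: real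
  assumes "a > 1" "N \<ge> 1" and C: "\<And>i j. norm (p i j) \<le> C i"
  obtains y and n :: "nat \<Rightarrow> nat"
  where "n 0 = 0" "\<And>i. N dvd n i" "\<And>i j. norm (y (n i + j) - p i j) \<le> 1 / real (Suc i) * a ^ j"
proof -
  have "\<exists>d\<ge>1. N dvd d \<and> B \<le> a ^ d" for B
  proof -
    obtain m where "B < a ^ m"
      using real_arch_pow[OF \<open>a > 1\<close>] by blast
    moreover have "a ^ m \<le> a ^ (N * Suc m)"
    proof (rule power_increasing)
      show "m \<le> N * Suc m"
        using mult_le_mono1[OF \<open>N \<ge> 1\<close>, of "Suc m"] by (simp only: mult_1 Suc_leD)
    qed (use \<open>a > 1\<close> in simp)
    ultimately have "B \<le> a ^ (N * Suc m)"
      by linarith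
    with \<open>N \<ge> 1\<close> show ?thesis
      by (intro exI[of _ "N * Suc m"]) simp
  qed
  then have "\<exists>d\<ge>1. N dvd d \<and>
      max (2 * real (Suc i) * C i) (2 * real (Suc (Suc i)) * C (Suc i)) \<le> a ^ d" for i
    by blast
  then obtain d where d: "\<And>i. d i \<ge> 1" "\<And>i. N dvd d i"
      "\<And>i. 2 * real (Suc i) * C i \<le> a ^ d i"
      "\<And>i. 2 * real (Suc (Suc i)) * C (Suc i) \<le> a ^ d i"
    by (metis max.bounded_iff)
  define n where "n i = sum d {..<i}" for i
  have n_Suc: "n (Suc i) = n i + d i" for i
    by (simp add: n_def)
  have "strict_mono n"
    using d(1) by (intro strict_monoI_Suc) (simp add: n_Suc Suc_le_lessD)
  then have n_mono: "i \<le> l \<Longrightarrow> n i \<le> n l" for i l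
    by (simp add: strict_mono_less_eq)
  \<comment> \<open>\<open>idx m\<close> is the number of the block that contains position \<open>m\<close>.\<close>
  define idx where "idx m = (LEAST i. m < n (Suc i))" for m
  define y where "y m = p (idx m) (m - n (idx m))" for m
  have idx_less: "m < n (Suc (idx m))" for m
  proof -
    have "m < n (Suc m)"
      using strict_mono_imp_increasing[OF \<open>strict_mono n\<close>, of "Suc m"] by simp
    then show ?thesis
      unfolding idx_def by (rule LeastI)
  qed
  have idx_le: "n (idx m) \<le> m" for m
  proof (cases "idx m")
    case 0
    then show ?thesis
      by (simp add: n_def)
  next
    case (Suc i)
    then have "\<not> m < n (Suc i)"
      using not_less_Least[of i "\<lambda>i. m < n (Suc i)"] by (simp add: idx_def)
    with Suc show ?thesis
      by simp
  qed
  have a_mono: "i \<le> j \<Longrightarrow> a ^ i \<le> a ^ j" for i j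
    using \<open>a > 1\<close> by (intro power_increasing) auto
  have "norm (y (n i + j) - p i j) \<le> 1 / real (Suc i) * a ^ j" for i j
  proof -
    define l where "l = idx (n i + j)"
    have l: "n l \<le> n i + j" "n i + j < n (Suc l)"
      using idx_le[of "n i + j"] idx_less[of "n i + j"] by (simp_all add: l_def)
    have "i \<le> l"
    proof (rule ccontr)
      assume "\<not> i \<le> l"
      then have "n (Suc l) \<le> n i"
        by (intro n_mono) simp
      with l(2) show False
        by simp
    qed
    show ?thesis
    proof (cases "l = i")
      case True
      then show ?thesis
        using \<open>a > 1\<close> by (simp add: y_def flip: l_def)
    next
      case False
      with \<open>i \<le> l\<close> obtain m where m: "l = Suc m" "i \<le> m"
        by (cases l) auto
      \<comment> \<open>Position \<open>n i + j\<close> lies beyond the blocks \<open>i\<close> and \<open>m\<close>, so \<open>a ^ j\<close> dominates both terms of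
        the difference; each may use half of the admitted error.\<close>
      have "d m \<le> j" "d i \<le> j"
        using l(1) n_mono[of i m] n_mono[of "Suc i" l] m by (simp_all add: n_Suc)
      have "norm (p i j) * (2 * real (Suc i)) \<le> C i * (2 * real (Suc i))"
        using C by (intro mult_right_mono) auto
      also have "\<dots> \<le> a ^ j"
        using d(3)[of i] a_mono[OF \<open>d i \<le> j\<close>] by (simp add: mult_ac)
      finally have 1: "norm (p i j) * (2 * real (Suc i)) \<le> a ^ j" .
      have "norm (y (n i + j)) * (2 * real (Suc i)) \<le> C l * (2 * real (Suc l))"
        using C \<open>i \<le> l\<close> order_trans[OF norm_ge_zero C]
        unfolding y_def l_def[symmetric] by (intro mult_mono) auto
      also have "\<dots> \<le> a ^ j"
        using d(4)[of m] a_mono[OF \<open>d m \<le> j\<close>] unfolding m by (simp add: mult_ac)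
      finally have 2: "norm (y (n i + j)) * (2 * real (Suc i)) \<le> a ^ j" .
      have "norm (y (n i + j) - p i j) * real (Suc i)
          \<le> (norm (y (n i + j)) + norm (p i j)) * real (Suc i)"
        by (intro mult_right_mono norm_triangle_ineq4) simp
      also have "\<dots> \<le> a ^ j"
        using 1 2 by (simp only: distrib_right mult.assoc mult.left_commute[of _ 2])
      finally show ?thesis
        by (simp add: field_simps del: of_nat_Suc)
    qed
  qed
  moreover have "N dvd n i" for i
    unfolding n_def using d(2) by (intro dvd_sum) auto
  moreover have "n 0 = 0"
    by (simp add: n_def)
  ultimately show ?thesis
    using that by blast
qed

text \<open>Finite sequences with entries from a countable dense set of scalars suffice: an
  approximation of \<open>w\<^bsup>t\<^sub>k\<^esup> x\<^sub>k\<close> becomes only better when it is divided by \<open>w\<^bsup>t\<^sub>k\<^esup>\<close>, and the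
  late entries of \<open>x\<close> are small anyway.\<close>

lemma dense_family:
  fixes w :: "'a::{real_normed_field, second_countable_topology}"
  assumes "norm w > 1"
  obtains q :: "nat \<Rightarrow> nat \<Rightarrow> 'a" and C :: "nat \<Rightarrow> real"
  where "\<And>i j. norm (q i j) \<le> C i" "\<And>x e. e > 0 \<Longrightarrow> \<exists>i. norm (unweight w (q i) - x) < e"
proof -
  obtain D :: "'a set" where D: "countable D" "\<And>X. open X \<Longrightarrow> X \<noteq> {} \<Longrightarrow> \<exists>d\<in>D. d \<in> X"
    using countable_dense_setE by blast
  define entry :: "'a list \<Rightarrow> nat \<Rightarrow> 'a" where
    "entry xs k = (if k < length xs then xs ! k else 0)" for xs k
  have entry_bound: "norm (entry xs k) \<le> (\<Sum>u\<leftarrow>xs. norm u)" for xs k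
    by (auto simp: entry_def intro!: member_le_sum_list sum_list_nonneg)
  have approx: "\<exists>xs\<in>lists D. norm (unweight w (entry xs) - x) < e" if e: "e > 0" for x e
  proof -
    obtain M where M: "\<And>k. k \<ge> M \<Longrightarrow> norm (coord x k) < e / 2"
      using coord_eventually_small[of "e / 2" x] e by auto
    have "\<forall>k. \<exists>u\<in>D. u \<in> ball (w ^ triangle k * coord x k) (e / 2)"
      using e by (intro allI D(2)) auto
    then obtain u where u: "\<And>k. u k \<in> D" "\<And>k. norm (w ^ triangle k * coord x k - u k) < e / 2"
      by (metis mem_ball dist_norm)
    let ?xs = "map u [0..<M]"
    have "norm (coord (unweight w (entry ?xs) - x) k) \<le> e / 2" for k
    proof (cases "k < M")
      case True
      have w: "1 \<le> norm w ^ triangle k"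
        using assms by (intro one_le_power) simp
      have "coord (unweight w (entry ?xs) - x) k = (u k - w ^ triangle k * coord x k) / w ^ triangle k"
        using True assms by (auto simp: coord_unweight exp_growth_bounded[OF entry_bound] entry_def
            diff_divide_distrib)
      then have "norm (coord (unweight w (entry ?xs) - x) k)
          = norm (w ^ triangle k * coord x k - u k) / norm w ^ triangle k"
        by (simp add: norm_divide norm_power norm_minus_commute)
      also have "\<dots> \<le> norm (w ^ triangle k * coord x k - u k) / 1"
        using w by (intro divide_left_mono) auto
      finally show ?thesis
        using u(2)[of k] by simp
    next
      case False
      then show ?thesis
        using M[of k] assms
        by (simp add: coord_unweight exp_growth_bounded[OF entry_bound] entry_def)
    qed
    then have "norm (unweight w (entry ?xs) - x) \<le> e / 2"
      by (rule norm_c0_leI)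
    then show ?thesis
      using u(1) e by (intro bexI[of _ ?xs]) auto
  qed
  show ?thesis
  proof (rule that)
    show "norm (entry (from_nat_into (lists D) i) j) \<le> (\<Sum>u\<leftarrow>from_nat_into (lists D) i. norm u)"
      for i j by (rule entry_bound)
    show "\<exists>i. norm (unweight w (entry (from_nat_into (lists D) i)) - x) < e" if "e > 0" for x e
      using approx[OF that, of x] from_nat_into_surj[OF countable_lists[OF D(1)]] by metis
  qed
qed

lemma hypercyclic_op_power_wshift:
  fixes w :: "'a::{real_normed_field, second_countable_topology}"
  assumes "norm w > 1" "N \<ge> 1"
  shows "hypercyclic (op_power (wshift w) N)"
proof -
  obtain q :: "nat \<Rightarrow> nat \<Rightarrow> 'a" and C
    where q: "\<And>i j. norm (q i j) \<le> C i" "\<And>x e. e > 0 \<Longrightarrow> \<exists>i. norm (unweight w (q i) - x) < e"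
    using dense_family[OF assms(1)] by blast
  \<comment> \<open>Each \<open>q i\<close> has to recur infinitely often, because the \<open>i\<close>-th block is met only up to the
    error \<open>1 / (i + 1)\<close>.\<close>
  define p where "p i = q (fst (prod_decode i))" for i
  have p: "norm (p i j) \<le> C (fst (prod_decode i))" for i j
    by (simp add: p_def q(1))
  obtain y n where n: "n 0 = 0" "\<And>i. N dvd n i"
    and y: "\<And>i j. norm (y (n i + j) - p i j) \<le> 1 / real (Suc i) * norm w ^ j"
    using concatenate_blocks[where p = p and C = "\<lambda>i. C (fst (prod_decode i))", OF assms p]
    by metis
  have p_growth: "exp_growth (p i)" for i
    by (rule exp_growth_bounded) (rule p)
  have y_growth: "exp_growth y"
  proof (rule exp_growthI)
    fix k
    let ?C = "C (fst (prod_decode 0))"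
    have "norm (y k) \<le> norm (p 0 k) + norm (y k - p 0 k)"
      using norm_triangle_ineq[of "p 0 k" "y k - p 0 k"] by simp
    also have "\<dots> \<le> ?C + norm w ^ k"
      using p[of 0 k] y[of 0 k] n(1) by simp
    also have "?C \<le> ?C * norm w ^ k"
      using mult_left_mono[of 1 "norm w ^ k" ?C] order_trans[OF norm_ge_zero p[of 0 0]]
        one_le_power[of "norm w" k] assms(1) by simp
    finally show "norm (y k) \<le> (?C + 1) * norm w ^ k"
      by (simp add: distrib_right)
  qed simp
  let ?A = "op_power (wshift w) N" and ?v = "unweight w y"
  have pow: "op_power ?A m ?v = Some (unweight w (\<lambda>k. y (N * m + k)))" for m
    by (simp add: op_power_mult op_power_wshift_unweight[OF assms(1) y_growth])
  have "\<exists>z\<in>range (\<lambda>m. the (op_power ?A m ?v)). dist z x < e" if e: "e > 0" for x e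
  proof -
    obtain s where s: "norm (unweight w (q s) - x) < e / 2"
      using q(2)[of "e / 2" x] e by auto
    obtain K where K: "1 / real (Suc K) < e / 2"
      using nat_approx_posE[of "e / 2"] e by auto
    define i where "i = prod_encode (s, K)"
    have "K \<le> i"
      by (simp add: i_def le_prod_encode_2)
    then have "1 / real (Suc i) \<le> 1 / real (Suc K)"
      by (intro divide_left_mono) auto
    with K have i: "1 / real (Suc i) < e / 2"
      by linarith
    have "p i = q s"
      by (simp add: p_def i_def)
    have "norm (unweight w (\<lambda>k. y (n i + k)) - unweight w (p i)) \<le> 1 / real (Suc i)"
      by (intro norm_unweight_diff_le assms(1) exp_growth_shift y_growth p_growth y)
    then have "norm (unweight w (\<lambda>k. y (n i + k)) - x) < e"
      using i s norm_triangle_ineq[of "unweight w (\<lambda>k. y (n i + k)) - unweight w (q s)"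
          "unweight w (q s) - x"] by (simp add: \<open>p i = q s\<close>)
    moreover obtain m where "n i = N * m"
      using n(2)[of i] by blast
    ultimately show ?thesis
      by (intro bexI[of _ "the (op_power ?A m ?v)"]) (auto simp: pow dist_norm)
  qed
  then have dense: "closure (range (\<lambda>m. the (op_power ?A m ?v))) = UNIV"
    unfolding set_eq_iff closure_approachable by blast
  have "?v \<noteq> 0"
  proof
    assume "?v = 0"
    then have "y k = 0" for k
      using coord_unweight[OF assms(1) y_growth, of k] assms(1) by auto
    then have "range (\<lambda>m. the (op_power ?A m ?v)) = {?v}"
      unfolding pow by (simp add: fun_eq_iff image_constant_conv flip: \<open>?v = 0\<close>) (metis ext)
    with dense have "UNIV = {?v}"
      by simp
    then show False
      using unweight_power_nonzero[OF assms(1), of 1] \<open>?v = 0\<close> by (metis UNIV_I singletonD)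
  qed
  moreover have "?v \<in> C_infinity ?A"
    unfolding C_infinity_def using pow by blast
  ultimately show ?thesis
    unfolding hypercyclic_def hypercyclic_vector_def using dense by blast
qed

lemma chaotic_op_power_wshift:
  fixes w :: "'a::{real_normed_field, second_countable_topology}"
  assumes "norm w > 1" "N \<ge> 1"
  shows "chaotic (op_power (wshift w) N)"
  unfolding chaotic_def
  using hypercyclic_op_power_wshift[OF assms] periodic_points_dense[OF assms(1)] by blast

section \<open>Chaos and point spectrum of the weighted shift\<close>

lemma chaotic_wshift:
  fixes w :: "'a::{real_normed_field, second_countable_topology}"
  assumes "norm w > 1"
  shows "chaotic (wshift w)"
  using chaotic_op_power_wshift[OF assms, of 1] op_power_1[of "wshift w"] by simp

lemma point_spectrum_wshift:
  assumes "norm w > 1"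
  shows "point_spectrum scale_c0 (wshift w) = UNIV"
proof -
  have "l \<in> point_spectrum scale_c0 (wshift w)" for l
    by (intro eigenvalue_in_point_spectrum linear_op_wshift eigenvalue_wshift assms)
      (rule c0_eqI, simp)
  then show ?thesis
    by blast
qed

theorem theorem3p2:
  shows
    "(\<forall>w :: real. norm w > 1 \<longrightarrow>
        chaotic (wshift w) \<and>
        (\<forall>n\<ge>1. chaotic (op_power (wshift w) n)) \<and>
        (\<forall>l :: real. eigenvalue scale_c0 (wshift w) l \<and>
           vector_space.dim scale_c0 (op_kernel (op_minus_scalar scale_c0 (wshift w) l)) = 1)) \<and>
     (\<forall>w :: complex. norm w > 1 \<longrightarrow>
        chaotic (wshift w) \<and>
        (\<forall>n\<ge>1. chaotic (op_power (wshift w) n)) \<and>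
        (\<forall>l :: complex. eigenvalue scale_c0 (wshift w) l \<and>
           vector_space.dim scale_c0 (op_kernel (op_minus_scalar scale_c0 (wshift w) l)) = 1) \<and>
        point_spectrum scale_c0 (wshift w) = UNIV)"
  by (intro conjI allI impI)
    (simp_all only: chaotic_wshift chaotic_op_power_wshift eigenvalue_wshift dim_op_kernel_wshift
      point_spectrum_wshift)

end
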